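(* Let $f : M \to \mathbb{R}$ be a smooth function on a closed manifold with finitely many critical points. Then $W_f = W^{\mathrm{p}}_f$, i.e. the Reeb space and the path Reeb space of $f$ coincide (as quotients of $M$).
   Context: Smooth means of class $C^\infty$. A manifold is closed if it is compact and has no boundary. Reeb space: for a continuous map $f : X \to Y$ and $x_0, x_1 \in X$, write $x_0 \sim x_1$ if $f(x_0) = f(x_1)$ and $x_0, x_1$ lie on the same connected component of $f^{-1}(f(x_0))$. The Reeb space is $W_f = X/\!\sim$ with the quotient topology. Path Reeb space: write $x_0 \sim_{\mathrm{p}} x_1$ if $f(x_0) = f(x_1)$ and $x_0, x_1$ lie on the same path-component of $f^{-1}(f(x_0))$. The path Reeb space is $W^{\mathrm{p}}_f = X/\!\sim_{\mathrm{p}}$ with the quotient topology. *)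

theory Defs
  imports "HOL-Analysis.Analysis"
begin

section \<open>Smooth functions on open subsets of \<open>Euclidean_space n\<close>\<close>

definition partial_deriv :: "nat \<Rightarrow> ((nat \<Rightarrow> real) \<Rightarrow> real) \<Rightarrow> (nat \<Rightarrow> real) \<Rightarrow> real" where
  "partial_deriv i g x = deriv (\<lambda>t. g (x(i := t))) (x i)"

text \<open>
  \<open>Ck_on n k V g\<close>, for \<open>V\<close> open in \<open>Euclidean_space n\<close>: all partial derivatives of \<open>g\<close> of order at
  most \<open>k\<close> exist and are continuous on \<open>V\<close>. Values of \<open>g\<close> outside \<open>V\<close> are irrelevant because \<open>V\<close>
  is open.
\<close>

primrec Ck_on :: "nat \<Rightarrow> nat \<Rightarrow> (nat \<Rightarrow> real) set \<Rightarrow> ((nat \<Rightarrow> real) \<Rightarrow> real) \<Rightarrow> bool" where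
  "Ck_on n 0 V g \<longleftrightarrow> continuous_map (subtopology (Euclidean_space n) V) euclideanreal g"
| "Ck_on n (Suc k) V g \<longleftrightarrow>
     continuous_map (subtopology (Euclidean_space n) V) euclideanreal g \<and>
     (\<forall>i<n. (\<forall>x\<in>V. (\<lambda>t. g (x(i := t))) differentiable (at (x i))) \<and>
            Ck_on n k V (partial_deriv i g))"

definition smooth_real_on :: "nat \<Rightarrow> (nat \<Rightarrow> real) set \<Rightarrow> ((nat \<Rightarrow> real) \<Rightarrow> real) \<Rightarrow> bool" where
  "smooth_real_on n V g \<longleftrightarrow> (\<forall>k. Ck_on n k V g)"

definition smooth_vec_on ::
    "nat \<Rightarrow> (nat \<Rightarrow> real) set \<Rightarrow> ((nat \<Rightarrow> real) \<Rightarrow> nat \<Rightarrow> real) \<Rightarrow> bool" where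
  "smooth_vec_on n V h \<longleftrightarrow> (\<forall>j<n. smooth_real_on n V (\<lambda>x. h x j))"

section \<open>Smooth manifolds\<close>

text \<open>
  A chart is a pair of its domain and its coordinate map. Being modelled on open subsets of
  \<open>Euclidean_space n\<close> (and not of a half space), the manifolds below have no boundary;
  \<open>n = 0\<close> is allowed.
\<close>

type_synonym 'a chart = "'a set \<times> ('a \<Rightarrow> nat \<Rightarrow> real)"

definition is_chart :: "nat \<Rightarrow> 'a topology \<Rightarrow> 'a chart \<Rightarrow> bool" where
  "is_chart n M = (\<lambda>(U, \<phi>). openin M U \<and> openin (Euclidean_space n) (\<phi> ` U) \<and>
     homeomorphic_map (subtopology M U) (subtopology (Euclidean_space n) (\<phi> ` U)) \<phi>)"

text \<open>
  The condition quantifies over all ordered pairs of charts, so both transition maps between two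
  charts are smooth.
\<close>

definition smooth_atlas :: "nat \<Rightarrow> 'a topology \<Rightarrow> 'a chart set \<Rightarrow> bool" where
  "smooth_atlas n M \<A> \<longleftrightarrow>
     (\<forall>c\<in>\<A>. is_chart n M c) \<and>
     (\<Union>(U, \<phi>)\<in>\<A>. U) = topspace M \<and>
     (\<forall>(U, \<phi>)\<in>\<A>. \<forall>(V, \<psi>)\<in>\<A>. smooth_vec_on n (\<phi> ` (U \<inter> V)) (\<psi> \<circ> inv_into U \<phi>))"

text \<open>
  The smooth structure is given by an atlas that need not be maximal. Smoothness of functions and
  critical points do not change when the atlas is enlarged to the maximal one.
\<close>

definition smooth_manifold :: "nat \<Rightarrow> 'a topology \<Rightarrow> 'a chart set \<Rightarrow> bool" where
  "smooth_manifold n M \<A> \<longleftrightarrow> Hausdorff_space M \<and> second_countable M \<and> smooth_atlas n M \<A>"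

definition closed_smooth_manifold :: "nat \<Rightarrow> 'a topology \<Rightarrow> 'a chart set \<Rightarrow> bool" where
  "closed_smooth_manifold n M \<A> \<longleftrightarrow> smooth_manifold n M \<A> \<and> compact_space M"

definition smooth_function :: "nat \<Rightarrow> 'a chart set \<Rightarrow> ('a \<Rightarrow> real) \<Rightarrow> bool" where
  "smooth_function n \<A> f \<longleftrightarrow> (\<forall>(U, \<phi>)\<in>\<A>. smooth_real_on n (\<phi> ` U) (f \<circ> inv_into U \<phi>))"

text \<open>
  The differential of \<open>f\<close> at \<open>p\<close> vanishes. By the chain rule, if the partial derivatives vanish in
  one chart around \<open>p\<close>, they vanish in every chart around \<open>p\<close>.
\<close>

definition critical_point :: "nat \<Rightarrow> 'a chart set \<Rightarrow> ('a \<Rightarrow> real) \<Rightarrow> 'a \<Rightarrow> bool" where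
  "critical_point n \<A> f p \<longleftrightarrow>
     (\<exists>(U, \<phi>)\<in>\<A>. p \<in> U \<and> (\<forall>i<n. partial_deriv i (f \<circ> inv_into U \<phi>) (\<phi> p) = 0))"

section \<open>Reeb space and path Reeb space\<close>

text \<open>
  The finest topology on \<open>topspace X // r\<close> making the projection \<open>x \<mapsto> r `` {x}\<close> continuous.
\<close>

definition quotient_topology :: "'a topology \<Rightarrow> ('a \<times> 'a) set \<Rightarrow> 'a set topology" where
  "quotient_topology X r =
     topology (\<lambda>\<U>. \<U> \<subseteq> topspace X // r \<and> openin X {x \<in> topspace X. r `` {x} \<in> \<U>})"

lemma openin_quotient_topology:
  "openin (quotient_topology X r) \<U> \<longleftrightarrow>
     \<U> \<subseteq> topspace X // r \<and> openin X {x \<in> topspace X. r `` {x} \<in> \<U>}"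
proof -
  have "istopology (\<lambda>\<U>. \<U> \<subseteq> topspace X // r \<and> openin X {x \<in> topspace X. r `` {x} \<in> \<U>})"
    unfolding istopology_def
  proof (intro conjI allI impI)
    fix S T
    assume S: "S \<subseteq> topspace X // r \<and> openin X {x \<in> topspace X. r `` {x} \<in> S}"
      and T: "T \<subseteq> topspace X // r \<and> openin X {x \<in> topspace X. r `` {x} \<in> T}"
    show "S \<inter> T \<subseteq> topspace X // r" using S by blast
    have "{x \<in> topspace X. r `` {x} \<in> S \<inter> T} =
        {x \<in> topspace X. r `` {x} \<in> S} \<inter> {x \<in> topspace X. r `` {x} \<in> T}" by blast
    then show "openin X {x \<in> topspace X. r `` {x} \<in> S \<inter> T}" using S T by auto
  next
    fix \<K>
    assume K: "\<forall>S\<in>\<K>. S \<subseteq> topspace X // r \<and> openin X {x \<in> topspace X. r `` {x} \<in> S}"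
    then show "\<Union>\<K> \<subseteq> topspace X // r" by blast
    have "{x \<in> topspace X. r `` {x} \<in> \<Union>\<K>} = (\<Union>S\<in>\<K>. {x \<in> topspace X. r `` {x} \<in> S})" by blast
    then show "openin X {x \<in> topspace X. r `` {x} \<in> \<Union>\<K>}" using K by auto
  qed
  then show ?thesis by (simp add: quotient_topology_def topology_inverse')
qed

lemma topspace_quotient_topology: "topspace (quotient_topology X r) = topspace X // r"
proof -
  have "{x \<in> topspace X. r `` {x} \<in> topspace X // r} = topspace X" by (auto intro: quotientI)
  then have "openin (quotient_topology X r) (topspace X // r)"
    by (simp add: openin_quotient_topology)
  then show ?thesis
    by (meson openin_quotient_topology openin_subset openin_topspace subset_antisym)
qed

lemma quotient_map_quotient_topology:
  "quotient_map X (quotient_topology X r) (\<lambda>x. r `` {x})"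
  by (auto simp: quotient_map_def topspace_quotient_topology openin_quotient_topology quotient_def)

definition fibre_through :: "'a topology \<Rightarrow> ('a \<Rightarrow> 'b) \<Rightarrow> 'a \<Rightarrow> 'a topology" where
  "fibre_through X f x = subtopology X {z \<in> topspace X. f z = f x}"

definition Reeb_rel :: "'a topology \<Rightarrow> ('a \<Rightarrow> 'b) \<Rightarrow> ('a \<times> 'a) set" where
  "Reeb_rel X f = {(x, y). x \<in> topspace X \<and> y \<in> topspace X \<and> f x = f y \<and>
                           connected_component_of (fibre_through X f x) x y}"

definition path_Reeb_rel :: "'a topology \<Rightarrow> ('a \<Rightarrow> 'b) \<Rightarrow> ('a \<times> 'a) set" where
  "path_Reeb_rel X f = {(x, y). x \<in> topspace X \<and> y \<in> topspace X \<and> f x = f y \<and>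
                                path_component_of (fibre_through X f x) x y}"

lemma equiv_Reeb_rel: "equiv (topspace X) (Reeb_rel X f)"
proof (rule equivI)
  show "Reeb_rel X f \<subseteq> topspace X \<times> topspace X" by (auto simp: Reeb_rel_def)
  show "refl_on (topspace X) (Reeb_rel X f)"
    by (auto simp: refl_on_def Reeb_rel_def fibre_through_def connected_component_of_refl)
  show "sym (Reeb_rel X f)"
    by (auto simp: sym_def Reeb_rel_def fibre_through_def connected_component_of_sym)
  show "trans (Reeb_rel X f)"
    unfolding trans_def Reeb_rel_def fibre_through_def
    by (auto intro: connected_component_of_trans)
qed

lemma equiv_path_Reeb_rel: "equiv (topspace X) (path_Reeb_rel X f)"
proof (rule equivI)
  show "path_Reeb_rel X f \<subseteq> topspace X \<times> topspace X" by (auto simp: path_Reeb_rel_def)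
  show "refl_on (topspace X) (path_Reeb_rel X f)"
    by (auto simp: refl_on_def path_Reeb_rel_def fibre_through_def path_component_of_refl)
  show "sym (path_Reeb_rel X f)"
    by (auto simp: sym_def path_Reeb_rel_def fibre_through_def path_component_of_sym)
  show "trans (path_Reeb_rel X f)"
    unfolding trans_def path_Reeb_rel_def fibre_through_def
    by (auto intro: path_component_of_trans)
qed

definition Reeb_space :: "'a topology \<Rightarrow> ('a \<Rightarrow> 'b) \<Rightarrow> 'a set topology" where
  "Reeb_space X f = quotient_topology X (Reeb_rel X f)"

definition path_Reeb_space :: "'a topology \<Rightarrow> ('a \<Rightarrow> 'b) \<Rightarrow> 'a set topology" where
  "path_Reeb_space X f = quotient_topology X (path_Reeb_rel X f)"

end

theory Submission
  imports Defs
begin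

text \<open>
  By the implicit function theorem a fibre \<open>F\<close> is locally path-connected away from the finite set
  \<open>S\<close> of critical points on it. Let \<open>K\<close> be a component of \<open>F\<close>; it is a continuum. If \<open>K\<close> failed to
  be locally connected at \<open>p \<in> S\<close>, boundary bumping would make infinitely many components of a small
  closed neighbourhood of \<open>p\<close> cross a compact frontier on which \<open>K\<close> is locally connected, which is
  impossible. Hence \<open>K\<close> has a decreasing base \<open>W 0, W 1, \<dots>\<close> of connected open neighbourhoods at \<open>p\<close>.
  Every component of \<open>W n - {p}\<close> accumulates at \<open>p\<close>, so a point of \<open>W n - {p}\<close> can be joined inside
  \<open>W n\<close> to a point of \<open>W (n + 1) - {p}\<close>; the infinite concatenation of such paths ends at \<open>p\<close>. So \<open>K\<close>
  is locally path-connected, hence path-connected.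
\<close>


section \<open>Continuum theory: local connectedness at an isolated exceptional point\<close>

text \<open>Boundary bumping forces every component of a closed neighbourhood \<open>C\<close> of
  \<open>p\<close> that comes near \<open>p\<close> to cross a compact set \<open>B\<close> away
  from \<open>p\<close>. Local connectedness along \<open>B\<close> leaves only finitely many such
  components, so those that miss \<open>p\<close> can be removed as one closed set.\<close>

lemma weakly_locally_connected_at_isolated:
  assumes X: "connected_space X" "compact_space X" "Hausdorff_space X"
    and N: "openin X N" "p \<in> N"
    and loc: "\<And>x. x \<in> N - {p} \<Longrightarrow> weakly_locally_connected_at x X"
  shows "weakly_locally_connected_at p X"
  unfolding weakly_locally_connected_at
proof (intro allI impI, elim conjE)
  fix V assume V: "openin X V" "p \<in> V"
  have base: "neighbourhood_base_of (closedin X) X"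
    using X compact_Hausdorff_imp_regular_space neighbourhood_base_of_closedin by blast
  have "openin X (V \<inter> N)" "p \<in> V \<inter> N"
    using N V by auto
  \<comment> \<open>Two nested closed neighbourhoods \<open>C' \<subseteq> W \<subseteq> C\<close>
    of \<open>p\<close>: components are taken in \<open>C\<close>, and they are counted on the
    frontier of \<open>C'\<close>, which lies in the open set \<open>W\<close> inside
    \<open>C\<close>.\<close>
  then obtain W C where W: "openin X W" "p \<in> W" "W \<subseteq> C" and C: "closedin X C" "C \<subseteq> V \<inter> N"
    using base unfolding neighbourhood_base_of by metis
  obtain W' C' where W': "openin X W'" "p \<in> W'" "W' \<subseteq> C'" and C': "closedin X C'" "C' \<subseteq> W"
    using base W unfolding neighbourhood_base_of by metis
  show "\<exists>U. openin X U \<and> p \<in> U \<and> U \<subseteq> V \<and>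
             (\<forall>y\<in>U. \<exists>C. connectedin X C \<and> C \<subseteq> V \<and> p \<in> C \<and> y \<in> C)"
  \<comment> \<open>Boundary bumping requires a proper subset; if \<open>C\<close> is the whole
    space, then \<open>C\<close> itself is the required connected set.\<close>
  proof (cases "C = topspace X")
    case True
    then have "connectedin X C"
      using X by (simp add: connectedin_topspace)
    then show ?thesis
      using W C by (intro exI[of _ W]) blast
  next
    case False
    define B where "B = X frontier_of C'"
    have B: "B \<subseteq> C'" "p \<notin> B" "compactin X B"
    proof -
      show "B \<subseteq> C'"
        using C' by (simp add: B_def frontier_of_subset_closedin)
      show "p \<notin> B"
        using W' interior_of_maximal[of W' C' X] by (auto simp: B_def frontier_of_def)
      show "compactin X B"
        using X by (simp add: B_def closedin_compact_space closedin_frontier_of)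
    qed
    define \<D> where "\<D> = {D \<in> connected_components_of (subtopology X C). D \<inter> C' \<noteq> {}}"
    have conn: "connectedin X D" "D \<subseteq> C" "closedin X D" if "D \<in> \<D>" for D
    proof -
      have "connectedin (subtopology X C) D"
        using that connectedin_connected_components_of by (auto simp: \<D>_def)
      then show "connectedin X D" "D \<subseteq> C"
        by (auto simp: connectedin_subtopology)
      show "closedin X D"
        using that C closedin_connected_components_of closedin_trans_full unfolding \<D>_def by blast
    qed
    \<comment> \<open>By boundary bumping \<open>D\<close> reaches the frontier of \<open>C\<close>,
      which is disjoint from \<open>C'\<close>. So the connected set \<open>D\<close> meets both
      \<open>C'\<close> and its complement, hence the frontier of \<open>C'\<close>.\<close>
    have meets: "D \<inter> B \<noteq> {}" if "D \<in> \<D>" for D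
    proof -
      have "D \<inter> X frontier_of C \<noteq> {}"
        using boundary_bumping_theorem_closed[OF X C(1) False] that by (auto simp: \<D>_def)
      moreover have "X frontier_of C \<inter> C' = {}"
        using C' W interior_of_maximal[of W C X] by (auto simp: frontier_of_def)
      ultimately show ?thesis
        unfolding B_def using that conn(1) by (intro connectedin_Int_frontier_of) (auto simp: \<D>_def)
    qed
    have "\<exists>U K. openin X U \<and> connectedin X K \<and> x \<in> U \<and> U \<subseteq> K \<and> K \<subseteq> W" if "x \<in> B" for x
    proof -
      have "x \<in> N - {p}" "x \<in> W"
        using B C' C W that by blast+
      then show ?thesis
        using loc W(1) unfolding weakly_locally_connected_at_def neighbourhood_base_at_def by blast
    qed
    then obtain U K where UK: "\<And>x. x \<in> B \<Longrightarrow>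
        openin X (U x) \<and> connectedin X (K x) \<and> x \<in> U x \<and> U x \<subseteq> K x \<and> K x \<subseteq> W"
      by metis
    have "\<exists>\<F>. finite \<F> \<and> \<F> \<subseteq> U ` B \<and> B \<subseteq> \<Union>\<F>"
      by (rule compactinD[OF B(3)]) (use UK in auto)
    then obtain T where T: "finite T" "T \<subseteq> B" "B \<subseteq> \<Union>(U ` T)"
      by (metis finite_subset_image)
    \<comment> \<open>A point of \<open>D \<inter> B\<close> lies in some \<open>K x\<close> with
      \<open>x \<in> T\<close>. As \<open>K x\<close> is connected and contained in
      \<open>C\<close>, it stays inside \<open>D\<close>, so \<open>x\<close> determines
      \<open>D\<close> and the finite set \<open>T\<close> bounds the number of components.\<close>
    have "\<exists>x\<in>T. connected_component_of_set (subtopology X C) x = D" if D: "D \<in> \<D>" for D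
    proof -
      obtain y where y: "y \<in> D" "y \<in> B"
        using meets[OF D] by blast
      then obtain x where x: "x \<in> T" "y \<in> U x"
        using T by blast
      have K: "connectedin (subtopology X C) (K x)" "x \<in> K x" "y \<in> K x"
        using UK[of x] x T W unfolding connectedin_subtopology by blast+
      then have "K x \<subseteq> D"
        using D y by (intro connected_components_of_maximal) (auto simp: \<D>_def disjnt_def)
      then have "x \<in> D" using K by auto
      then have "connected_component_of_set (subtopology X C) x = D"
        using D by (auto simp: \<D>_def connected_components_of_def)
          (metis connected_component_of_equiv)+
      with x show ?thesis by blast
    qed
    then have "\<D> \<subseteq> connected_component_of_set (subtopology X C) ` T"
      by blast
    then have "finite \<D>"
      using T finite_surj by blast
    \<comment> \<open>Finiteness of \<open>\<D>\<close> is used here: it makes \<open>Q\<close>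
      closed, so \<open>W' - Q\<close> is an open neighbourhood of \<open>p\<close>, and each of its
      points shares a component of \<open>C\<close> with \<open>p\<close>.\<close>
    define Q where "Q = \<Union>{D \<in> \<D>. p \<notin> D}"
    have Q: "closedin X Q"
      unfolding Q_def using \<open>finite \<D>\<close> conn by (intro closedin_Union) auto
    show ?thesis
    proof (rule exI[of _ "W' - Q"], intro conjI ballI)
      show "openin X (W' - Q)"
        using W' Q by auto
      show "p \<in> W' - Q" using W' by (auto simp: Q_def)
      show "W' - Q \<subseteq> V" using W' C' W C by blast
      fix y assume y: "y \<in> W' - Q"
      then have "y \<in> topspace (subtopology X C)"
        using W' C' W openin_subset by fastforce
      then obtain D where D: "D \<in> connected_components_of (subtopology X C)" "y \<in> D"
        using Union_connected_components_of by fastforce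
      then have "D \<in> \<D>" using y W' by (auto simp: \<D>_def)
      moreover from this have "p \<in> D" using y D by (auto simp: Q_def)
      ultimately show "\<exists>C. connectedin X C \<and> C \<subseteq> V \<and> p \<in> C \<and> y \<in> C"
        using conn[of D] C D by blast
    qed
  qed
qed

section \<open>Local path-connectedness at an isolated exceptional point\<close>

text \<open>The infinite concatenation is continuous at its end because all paths from the
  \<open>n\<close>-th on stay in \<open>W n\<close>, and these sets shrink to
  \<open>p\<close>.\<close>

lemma infinite_path_to_limit:
  assumes g: "\<And>n. path_component_of (subtopology X (W n)) (x n) (x (Suc n))"
    and dec: "decseq W" and p: "p \<in> topspace X" "\<And>n. p \<in> W n"
    and base: "\<And>U. openin X U \<Longrightarrow> p \<in> U \<Longrightarrow> \<exists>n. W n \<subseteq> U"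
  shows "path_component_of (subtopology X (W 0)) (x 0) p"
proof -
  define Y where "Y = subtopology X (W 0)"
  have "\<exists>h. pathin (subtopology X (W n)) h \<and> h 0 = x n \<and> h 1 = x (Suc n)" for n
    using g by (simp add: path_component_of_set)
  then obtain h where h: "\<And>n. pathin (subtopology X (W n)) (h n)"
      "\<And>n. h n 0 = x n" "\<And>n. h n 1 = x (Suc n)"
    by metis
  have hW: "h n t \<in> W n" if "t \<in> {0..1}" for n t
    using h(1)[of n] that by (auto simp: pathin_def continuous_map_def Pi_iff)
  have hY: "pathin Y (h n)" for n
    using h(1)[of n] dec unfolding Y_def pathin_subtopology decseq_def by blast
  define H where "H t = h (nat \<lfloor>t\<rfloor>) (t - of_int \<lfloor>t\<rfloor>)" for t :: real
  have H: "continuous_map (top_of_set {0..}) Y H"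
  proof (rule pasting_lemma_locally_finite[where I = UNIV and T = "\<lambda>n. {real n..real n + 1}"
        and f = "\<lambda>n t. h n (t - real n)"])
    fix t :: real assume "t \<in> topspace (top_of_set {0..})"
    show "\<exists>V. openin (top_of_set {0..}) V \<and> t \<in> V \<and> finite {i \<in> UNIV. {real i..real i + 1} \<inter> V \<noteq> {}}"
    proof (intro exI conjI)
      show "openin (top_of_set {0..}) ({0..} \<inter> {..<t + 1})"
        by (intro openin_open_Int) auto
      show "t \<in> {0..} \<inter> {..<t + 1}" using \<open>t \<in> topspace _\<close> by auto
      have "i \<le> nat \<lceil>t + 1\<rceil>" if "{real i..real i + 1} \<inter> ({0..} \<inter> {..<t + 1}) \<noteq> {}" for i
        using that by auto linarith
      then show "finite {i \<in> UNIV. {real i..real i + 1} \<inter> ({0..} \<inter> {..<t + 1}) \<noteq> {}}"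
        unfolding finite_nat_set_iff_bounded_le by blast
    qed
    show "\<exists>j. j \<in> UNIV \<and> t \<in> {real j..real j + 1} \<and> H t = h j (t - real j)"
      using \<open>t \<in> topspace _\<close> by (intro exI[of _ "nat \<lfloor>t\<rfloor>"]) (auto simp: H_def)
  next
    fix n :: nat
    show "closedin (top_of_set {0..}) {real n..real n + 1}"
      by (rule closed_subset) auto
    have "continuous_map (top_of_set {real n..real n + 1}) Y (h n \<circ> (\<lambda>t. t - real n))"
      by (rule continuous_map_compose[OF _ hY[of n, unfolded pathin_def]])
        (auto intro!: continuous_intros)
    then show "continuous_map (subtopology (top_of_set {0..}) {real n..real n + 1}) Y
        (\<lambda>t. h n (t - real n))"
      by (simp add: subtopology_subtopology o_def Int_absorb1)
  next
    fix i j :: nat and t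
    assume "t \<in> topspace (top_of_set {0..}) \<inter> {real i..real i + 1} \<inter> {real j..real j + 1}"
    then have "i = j \<or> (j = Suc i \<and> t = real j) \<or> (i = Suc j \<and> t = real i)"
      by auto
    then show "h i (t - real i) = h j (t - real j)"
      using h by auto
  qed
  have HW: "H t \<in> W n" if "t \<ge> real n" for t n
  proof -
    have "H t \<in> W (nat \<lfloor>t\<rfloor>)"
      unfolding H_def by (rule hW) (auto, linarith)
    moreover have "n \<le> nat \<lfloor>t\<rfloor>" using that by linarith
    ultimately show ?thesis using dec unfolding decseq_def by blast
  qed
  \<comment> \<open>The substitution \<open>t / (1 - t)\<close> maps \<open>[0, 1)\<close> onto
    \<open>[0, \<infinity>)\<close>; the limit \<open>p\<close> is added at time 1.\<close>
  define G where "G t = (if t < 1 then H (t / (1 - t)) else p)" for t :: real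
  have G1: "continuous_map (top_of_set {0..<1}) Y G"
  proof (rule continuous_map_eq)
    show "continuous_map (top_of_set {0..<1}) Y (H \<circ> (\<lambda>t. t / (1 - t)))"
      by (rule continuous_map_compose[OF _ H]) (auto intro!: continuous_intros)
  qed (auto simp: G_def)
  have "continuous_map (top_of_set {0..1}) Y G"
    unfolding continuous_map
  proof (intro conjI allI impI)
    have "G t \<in> topspace Y" if "t \<in> {0..1}" for t
      using that p G1 by (cases "t < 1") (auto simp: Y_def G_def continuous_map_def Pi_iff)
    then show "G ` topspace (top_of_set {0..1}) \<subseteq> topspace Y" by auto
    fix U assume U: "openin Y U"
    have 1: "openin (top_of_set {0..<1}) {t \<in> {0..<1}. G t \<in> U}"
      using openin_continuous_map_preimage[OF G1 U] by simp
    have "openin (top_of_set {0..1}) ({0..1} \<inter> {..<1::real})"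
      by (intro openin_open_Int) auto
    moreover have "{0..1} \<inter> {..<1::real} = {0..<1}" by auto
    ultimately have 2: "openin (top_of_set {0..1}) {t \<in> {0..<1}. G t \<in> U}"
      using 1 openin_trans by metis
    show "openin (top_of_set {0..1}) {t \<in> topspace (top_of_set {0..1}). G t \<in> U}"
    proof (cases "p \<in> U")
      case False
      then have "{t \<in> topspace (top_of_set {0..1}). G t \<in> U} = {t \<in> {0..<1}. G t \<in> U}"
        by (auto simp: G_def less_le)
      with 2 show ?thesis by simp
    next
      case True
      obtain U' where U': "openin X U'" "U = U' \<inter> W 0"
        using U by (auto simp: Y_def openin_subtopology)
      then obtain n where n: "W n \<subseteq> U'" using base True by blast
      \<comment> \<open>The bound \<open>n / (n + 1)\<close> is the time at which
        \<open>t / (1 - t)\<close> equals \<open>n\<close>; from there on \<open>H\<close> stays in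
        \<open>W n\<close>.\<close>
      have "G t \<in> U" if "t \<in> {0..1}" "t > real n / (real n + 1)" for t
      proof (cases "t < 1")
        case True
        then have "t / (1 - t) \<ge> real n" "t / (1 - t) \<ge> real 0" 
          using that by (auto simp: field_simps)
        then have "H (t / (1 - t)) \<in> W n" "H (t / (1 - t)) \<in> W 0" using HW by blast+
        then show ?thesis using n U' True by (auto simp: G_def)
      qed (use \<open>p \<in> U\<close> in \<open>auto simp: G_def\<close>)
      moreover have "real n / (real n + 1) < 1" by simp
      ultimately have "{t \<in> topspace (top_of_set {0..1}). G t \<in> U} =
          {t \<in> {0..<1}. G t \<in> U} \<union> ({0..1} \<inter> {real n / (real n + 1)<..})"
        by (auto simp: less_le)
      moreover have "openin (top_of_set {0..1}) ({0..1} \<inter> {real n / (real n + 1)<..})"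
        by (intro openin_open_Int) auto
      ultimately show ?thesis using 2 by auto
    qed
  qed
  moreover have "G 0 = x 0" "G 1 = p"
    using h by (auto simp: G_def H_def)
  ultimately show ?thesis
    unfolding path_component_of_def pathin_def Y_def by blast
qed

text \<open>Near an exceptional point \<open>p\<close>, first countability and local connectedness
  give a decreasing base of connected open sets \<open>W n\<close>. Connectedness of
  \<open>W n\<close> lets a path move from any point other than \<open>p\<close> into
  \<open>W (Suc n)\<close>, and the limit of these moves reaches \<open>p\<close>.\<close>

lemma locally_path_connected_space_isolated:
  assumes X: "locally_connected_space X" "Hausdorff_space X" "first_countable X"
    and S: "finite S" and loc: "locally_path_connected_space (subtopology X (topspace X - S))"
  shows "locally_path_connected_space X"
  unfolding locally_path_connected_space_im_kleinen
proof (intro allI impI, elim conjE)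
  fix V p assume V: "openin X V" "p \<in> V"
  have openS: "openin X (A - F)" if "openin X A" "finite F" for A F
    using that closedin_Hausdorff_finite[OF X(2), of "F \<inter> topspace X"] openin_subset[of X A]
      openin_diff[of X A "F \<inter> topspace X"]
    by (metis Diff_Int2 Int_absorb2 finite_Int inf_le2)
  \<comment> \<open>Deleting the other points of the finite set \<open>S\<close> leaves
    \<open>p\<close> as the only possible exceptional point in \<open>V'\<close>.\<close>
  define V' where "V' = V - (S - {p})"
  have V': "openin X V'" "p \<in> V'" "V' \<subseteq> V" "V' - {p} \<subseteq> topspace X - S"
    using V S openS[of V "S - {p}"] openin_subset[of X V] by (auto simp: V'_def)
  have pX: "p \<in> topspace X" using V openin_subset by blast
  have locV: "locally_path_connected_space (subtopology X A)" if "openin X A" "A \<subseteq> V' - {p}" for A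
  proof -
    have "subtopology X A = subtopology (subtopology X (topspace X - S)) A"
      using that V' by (simp add: subtopology_subtopology Int_absorb1)
    moreover have "openin (subtopology X (topspace X - S)) A"
      using that V' openS[OF openin_topspace S] by (simp add: openin_open_subtopology)
    ultimately show ?thesis using loc locally_path_connected_space_open_subset by metis
  qed
  obtain \<B> where \<B>: "countable \<B>" "\<And>B. B \<in> \<B> \<Longrightarrow> openin X B"
      "\<And>U. openin X U \<Longrightarrow> p \<in> U \<Longrightarrow> \<exists>B\<in>\<B>. p \<in> B \<and> B \<subseteq> U"
    using X(3) pX unfolding first_countable_def by metis
  define \<B>' where "\<B>' = {B \<in> \<B>. p \<in> B}"
  have "\<B>' \<noteq> {}" "countable \<B>'" using \<B>(1) \<B>(3)[OF V] by (auto simp: \<B>'_def)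
  define b where "b = from_nat_into \<B>'"
  have b: "range b = \<B>'"
    using \<open>\<B>' \<noteq> {}\<close> \<open>countable \<B>'\<close> unfolding b_def by (rule range_from_nat_into)
  have b': "openin X (b n)" "p \<in> b n" for n
  proof -
    have "b n \<in> \<B>'" using b by blast
    then show "openin X (b n)" "p \<in> b n" using \<B>(2) by (auto simp: \<B>'_def)
  qed
  have step: "\<exists>U. openin X U \<and> connectedin X U \<and> p \<in> U \<and> U \<subseteq> A \<inter> b n"
    if "openin X A" "p \<in> A" for A n
  proof -
    have "openin X (A \<inter> b n)" "p \<in> A \<inter> b n" using that b' by auto
    then show ?thesis using X(1) unfolding locally_connected_space by blast
  qed
  \<comment> \<open>The sets \<open>b n\<close> enumerate a countable local base at
    \<open>p\<close>. Requiring \<open>W n \<subseteq> b n\<close> makes the decreasing sequence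
    \<open>W\<close> a local base too.\<close>
  have "\<exists>W. \<forall>n. (openin X (W n) \<and> connectedin X (W n) \<and> p \<in> W n \<and> W n \<subseteq> V' \<inter> b n) \<and>
            W (Suc n) \<subseteq> W n"
  proof (rule dependent_nat_choice)
    show "\<exists>U. openin X U \<and> connectedin X U \<and> p \<in> U \<and> U \<subseteq> V' \<inter> b 0"
      using step V' by blast
    fix A n assume A: "openin X A \<and> connectedin X A \<and> p \<in> A \<and> A \<subseteq> V' \<inter> b n"
    then obtain U where "openin X U" "connectedin X U" "p \<in> U" "U \<subseteq> A \<inter> b (Suc n)"
      using step by metis
    with A show "\<exists>U. (openin X U \<and> connectedin X U \<and> p \<in> U \<and> U \<subseteq> V' \<inter> b (Suc n)) \<and> U \<subseteq> A"
      by blast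
  qed
  then obtain W where W: "\<And>n. openin X (W n)" "\<And>n. connectedin X (W n)" "\<And>n. p \<in> W n"
      "\<And>n. W n \<subseteq> V'" "\<And>n. W n \<subseteq> b n" "\<And>n. W (Suc n) \<subseteq> W n"
    by blast
  have dec: "decseq W" using W(6) by (simp add: decseq_SucI)
  have base: "\<exists>n. W n \<subseteq> U" if "openin X U" "p \<in> U" for U
  proof -
    have "\<exists>B\<in>\<B>'. B \<subseteq> U" using \<B>(3)[OF that] by (auto simp: \<B>'_def)
    then obtain B where "B \<in> \<B>'" "B \<subseteq> U" by blast
    then show ?thesis using b W(5) by (metis imageE subset_trans)
  qed
  have advance: "\<exists>z. z \<in> W (Suc n) - {p} \<and> path_component_of (subtopology X (W n)) y z"
    if y: "y \<in> W n - {p}" for y n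
  proof -
    define L where "L = subtopology X (W n - {p})"
    have openL: "openin X (W n - {p})" using openS[OF W(1)] by blast
    have topL: "topspace L = W n - {p}"
      using openin_subset[OF openL] by (auto simp: L_def)
    have L: "locally_path_connected_space L"
      unfolding L_def using W(4)[of n] by (intro locV openL) auto
    define C where "C = path_component_of_set L y"
    have "y \<in> C" using y topL by (simp add: C_def path_component_of_refl)
    have "openin L C"
      using L openin_path_component_of_locally_path_connected_space by (auto simp: C_def)
    then have C: "openin X C" "C \<subseteq> W n - {p}"
      using openL openin_trans_full unfolding L_def
      by (blast, metis openin_open_subtopology)
    have "closedin L C"
      using L closedin_path_component_of_locally_path_connected_space by (auto simp: C_def)
    then have "openin L (W n - {p} - C)"
      using topL by (metis openin_closedin_eq Diff_subset closedin_def)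
    then have C': "openin X (W n - {p} - C)"
      using openL openin_trans_full unfolding L_def by blast
    \<comment> \<open>Path components of the locally path-connected space \<open>L\<close> are
      clopen in \<open>L\<close>. If \<open>C\<close> missed \<open>W (Suc n)\<close>, then
      \<open>C\<close> and the open set \<open>?E\<close>, which contains \<open>p\<close>, would
      separate the connected set \<open>W n\<close>.\<close>
    have "C \<inter> W (Suc n) \<noteq> {}"
    proof
      assume disj: "C \<inter> W (Suc n) = {}"
      let ?E = "W (Suc n) \<union> (W n - {p} - C)"
      have "openin X ?E" using C' W(1) by blast
      moreover have "W n \<subseteq> C \<union> ?E" "C \<inter> ?E \<inter> W n = {}"
        using W(3)[of "Suc n"] disj by auto
      moreover have "C \<inter> W n \<noteq> {}" using \<open>y \<in> C\<close> C by blast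
      moreover have "?E \<inter> W n \<noteq> {}" using W(3) by blast
      ultimately show False using W(2)[of n] C(1) unfolding connectedin by blast
    qed
    then obtain z where z: "z \<in> C" "z \<in> W (Suc n)" by blast
    then have "path_component_of (subtopology X (W n)) y z"
      using path_component_of_mono[of X "W n - {p}" y z "W n"] by (auto simp: C_def L_def)
    then show ?thesis using z C by blast
  qed
  show "\<exists>U. openin X U \<and> p \<in> U \<and> U \<subseteq> V \<and>
             (\<forall>y\<in>U. \<exists>C. path_connectedin X C \<and> C \<subseteq> V \<and> p \<in> C \<and> y \<in> C)"
  proof (rule exI[of _ "W 0"], intro conjI ballI)
    show "openin X (W 0)" "p \<in> W 0" "W 0 \<subseteq> V" using W V' by blast+
    fix y assume y: "y \<in> W 0"
    have "path_component_of (subtopology X (W 0)) y p"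
    proof (cases "y = p")
      case True
      then show ?thesis using W pX by (simp add: path_component_of_refl)
    next
      case False
      have "\<exists>x. \<forall>n. (x n \<in> W n - {p} \<and> (n = 0 \<longrightarrow> x n = y)) \<and>
              path_component_of (subtopology X (W n)) (x n) (x (Suc n))"
        by (rule dependent_nat_choice) (use False y advance in auto)
      then obtain x where x: "x 0 = y"
          "\<And>n. path_component_of (subtopology X (W n)) (x n) (x (Suc n))"
        by metis
      show ?thesis
        using infinite_path_to_limit[of X W x p] x dec pX W(3) base by blast
    qed
    then show "\<exists>C. path_connectedin X C \<and> C \<subseteq> V \<and> p \<in> C \<and> y \<in> C"
      using W(4)[of 0] V'(3) unfolding path_component_of path_connectedin_subtopology by blast
  qed
qed

text \<open>A component of a compact Hausdorff space is closed, hence a continuum. The two preceding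
  extension results, for local connectedness and for local path-connectedness, apply to it in turn,
  and a connected, locally path-connected space is path-connected.\<close>

proposition path_component_eq_connected_component_of_isolated:
  assumes X: "compact_space X" "Hausdorff_space X" "first_countable X"
    and S: "finite S" and loc: "locally_path_connected_space (subtopology X (topspace X - S))"
  shows "path_component_of_set X x = connected_component_of_set X x"
proof (cases "x \<in> topspace X")
  case False
  then show ?thesis
    using connected_component_of_eq_empty path_component_of_eq_empty by fastforce
next
  case True
  define K where "K = connected_component_of_set X x"
  define Y where "Y = subtopology X K"
  have K: "closedin X K" "connectedin X K" "x \<in> K"
    unfolding K_def
    using True by (auto simp: closedin_connected_component_of connectedin_connected_component_of
        connected_component_of_refl)
  then have KX: "K \<subseteq> topspace X" using closedin_subset by blast
  then have topY: "topspace Y = K" by (auto simp: Y_def)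
  have Y: "compact_space Y" "Hausdorff_space Y" "first_countable Y" "connected_space Y"
    using K X by (auto simp: Y_def closedin_compact_space compact_space_subtopology
        Hausdorff_space_subtopology first_countable_subtopology connectedin_def)
  define Z where "Z = subtopology X (topspace X - S)"
  \<comment> \<open>A component need not be open in \<open>X\<close>. Off \<open>S\<close> it is
    open, since path components of \<open>Z\<close> are open and never leave \<open>K\<close>; this
    is what passes the local hypothesis from \<open>Z\<close> to \<open>K\<close>.\<close>
  have KZ: "openin Z (K - S)"
    unfolding openin_subopen[of Z "K - S"]
  proof
    fix y assume y: "y \<in> K - S"
    then have yZ: "y \<in> topspace Z" using KX by (auto simp: Z_def)
    have "path_component_of_set Z y \<subseteq> connected_component_of_set Z y"
      by (rule path_component_subset_connected_component_of)
    also have "\<dots> \<subseteq> connected_component_of_set X y"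
      unfolding Z_def using connected_component_of_mono[of X "topspace X - S" y _ "topspace X"]
      by (auto simp: subtopology_topspace)
    also have "\<dots> = K"
      using y unfolding K_def by (metis Diff_iff connected_component_of_equiv mem_Collect_eq)
    finally have "path_component_of_set Z y \<subseteq> K - S"
      using path_component_of_subset_topspace[of Z y] by (auto simp: Z_def)
    then show "\<exists>T. openin Z T \<and> y \<in> T \<and> T \<subseteq> K - S"
      using yZ loc openin_path_component_of_locally_path_connected_space[of Z y]
      by (intro exI[of _ "path_component_of_set Z y"]) (auto simp: Z_def path_component_of_refl)
  qed
  then have "locally_path_connected_space (subtopology Z (K - S))"
    using loc locally_path_connected_space_open_subset unfolding Z_def by blast
  moreover have "subtopology Z (K - S) = subtopology Y (topspace Y - S)"
    using KX unfolding topY unfolding Y_def Z_def subtopology_subtopology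
    by (metis Diff_mono Diff_subset Int_absorb1 order_refl)
  ultimately have locY: "locally_path_connected_space (subtopology Y (topspace Y - S))"
    by simp
  have SY: "openin Y (topspace Y - F)" if "finite F" for F
    using that closedin_Hausdorff_finite[OF Y(2), of "F \<inter> topspace Y"]
      openin_diff[of Y "topspace Y" "F \<inter> topspace Y"]
    by (metis Diff_Int2 Int_absorb finite_Int inf_le2 openin_topspace)
  have off: "weakly_locally_connected_at y Y" if y: "y \<in> topspace Y - S" for y
    unfolding weakly_locally_connected_at_def neighbourhood_base_at_def
  proof (intro allI impI, elim conjE)
    fix V assume V: "openin Y V" "y \<in> V"
    then have "openin (subtopology Y (topspace Y - S)) (V \<inter> (topspace Y - S))"
      using openin_subtopology by blast
    then obtain U where "openin (subtopology Y (topspace Y - S)) U"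
        "path_connectedin (subtopology Y (topspace Y - S)) U" "y \<in> U" "U \<subseteq> V \<inter> (topspace Y - S)"
      using locY V y unfolding locally_path_connected_space by (metis IntI)
    then show "\<exists>A B. openin Y A \<and> connectedin Y B \<and> y \<in> A \<and> A \<subseteq> B \<and> B \<subseteq> V"
      using SY[OF S]
      by (intro exI[of _ U]) (auto simp: openin_open_subtopology path_connectedin_subtopology
          path_connectedin_imp_connectedin)
  qed
  \<comment> \<open>The neighbourhood on which \<open>y\<close> is the only possible exception is
    the complement of the finite set \<open>S - {y}\<close>.\<close>
  have "weakly_locally_connected_at y Y" if "y \<in> topspace Y" for y
  proof (rule weakly_locally_connected_at_isolated[OF Y(4,1,2)])
    show "openin Y (topspace Y - (S - {y}))" using SY S by blast
    show "y \<in> topspace Y - (S - {y})" using that by blast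
  qed (use off in blast)
  then have "locally_connected_space Y"
    by (simp add: locally_connected_space_iff_weak)
  then have "locally_path_connected_space Y"
    using locally_path_connected_space_isolated Y(2,3) S locY by blast
  then have "path_connectedin X K"
    using Y(4) KX path_connected_eq_connected_space unfolding path_connectedin_def Y_def by blast
  then have "K \<subseteq> path_component_of_set X x"
    using K by (intro path_component_of_maximal)
  then show ?thesis
    using path_component_subset_connected_component_of[of X x] unfolding K_def
    by (rule subset_antisym[rotated])
qed

section \<open>Regular level sets in Euclidean space: a topological implicit function
  argument\<close>

lemma Euclidean_space_eq: "Euclidean_space n = top_of_set {y. \<forall>m\<ge>n. y m = 0}"
  by (simp add: Euclidean_space_def euclidean_product_topology)

text \<open>A basic open set of the infinite product has no uniform radius in general, but
  coordinates from \<open>n\<close> on vanish, so the minimum of the first \<open>n\<close> radii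
  suffices.\<close>

lemma openin_Euclidean_space_contains_box:
  assumes "openin (Euclidean_space n) W" "x \<in> W"
  obtains r where "r > 0"
    "\<And>y. \<lbrakk>\<forall>m\<ge>n. y m = 0; \<forall>j<n. \<bar>y j - x j\<bar> < r\<rbrakk> \<Longrightarrow> y \<in> W"
proof -
  obtain T where T: "openin (powertop_real UNIV) T" "W = T \<inter> {y. \<forall>m\<ge>n. y m = 0}"
    using assms unfolding Euclidean_space_def openin_subtopology by blast
  obtain B where B: "x \<in> Pi\<^sub>E UNIV B" "\<And>i. open (B i)" "Pi\<^sub>E UNIV B \<subseteq> T"
    using product_topology_open_contains_basis[OF T(1), of x] assms T by auto
  have "\<exists>e>0. \<forall>t. \<bar>t - x j\<bar> < e \<longrightarrow> t \<in> B j" for j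
    using B by (metis PiE_iff UNIV_I open_real)
  then obtain e where e: "\<And>j. e j > 0" "\<And>j t. \<bar>t - x j\<bar> < e j \<Longrightarrow> t \<in> B j"
    by metis
  \<comment> \<open>The element 1 keeps the set nonempty when \<open>n = 0\<close>.\<close>
  define r where "r = Min (insert 1 (e ` {..<n}))"
  show thesis
  proof
    show "r > 0" using e by (auto simp: r_def)
    have r: "r \<le> e j" if "j < n" for j using that by (auto simp: r_def)
    fix y assume y: "\<forall>m\<ge>n. y m = 0" "\<forall>j<n. \<bar>y j - x j\<bar> < r"
    have "y j \<in> B j" for j
    proof (cases "j < n")
      case True
      then show ?thesis using e(2) r y by (meson less_le_trans)
    next
      case False
      then show ?thesis using y e(2)[of "y j" j] e(1)[of j] assms(2) T(2) by auto
    qed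
    then show "y \<in> W" using B y T by auto
  qed
qed

lemma continuous_on_fun_upd:
  fixes w :: "'a::topological_space \<Rightarrow> 'b \<Rightarrow> 'c::topological_space"
  assumes "\<And>j. continuous_on A (\<lambda>a. w a j)" "continuous_on A u"
  shows "continuous_on A (\<lambda>a. (w a)(i := u a))"
proof (rule continuous_on_coordinatewise_then_product)
  show "continuous_on A (\<lambda>a. ((w a)(i := u a)) j)" for j
    using assms by (cases "j = i") simp_all
qed

text \<open>The implicit function along the segment between two points of the level set is
  continuous because its graph is closed.\<close>

lemma monotone_level_set_path_connected:
  fixes g :: "(nat \<Rightarrow> real) \<Rightarrow> real" and x :: "nat \<Rightarrow> real"
  assumes i: "i < n" and x: "\<forall>m\<ge>n. x m = 0" and r: "r > 0"
    and cont: "continuous_on {y. (\<forall>m\<ge>n. y m = 0) \<and> (\<forall>j<n. \<bar>y j - x j\<bar> < r)} g"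
    and mono: "\<And>y s t. \<lbrakk>\<forall>m\<ge>n. y m = 0; \<forall>j<n. \<bar>y j - x j\<bar> < r; \<bar>s - x i\<bar> < r; \<bar>t - x i\<bar> < r; s < t\<rbrakk>
                 \<Longrightarrow> g (y(i := s)) < g (y(i := t))"
  obtains Q where "openin (Euclidean_space n) Q" "x \<in> Q" "\<And>y j. \<lbrakk>y \<in> Q; j < n\<rbrakk> \<Longrightarrow> \<bar>y j - x j\<bar> < r"
    "path_connected {y \<in> Q. g y = g x}"
proof -
  define B where "B = {y. (\<forall>m\<ge>n. y m = 0) \<and> (\<forall>j<n. \<bar>y j - x j\<bar> < r)}"
  have box: "openin (Euclidean_space n) {y. (\<forall>m\<ge>n. y m = 0) \<and> (\<forall>j<n. \<bar>y j - x j\<bar> < d j)}"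
    for d :: "nat \<Rightarrow> real"
  proof -
    have "open (\<Inter>j<n. {y :: nat \<Rightarrow> real. \<bar>y j - x j\<bar> < d j})"
      by (intro open_INT ballI open_Collect_less continuous_intros continuous_on_product_coordinates) auto
    then have "openin (Euclidean_space n)
        ({y. \<forall>m\<ge>n. y m = 0} \<inter> (\<Inter>j<n. {y. \<bar>y j - x j\<bar> < d j}))"
      unfolding Euclidean_space_eq by (rule openin_open_Int)
    moreover have "{y. \<forall>m\<ge>n. y m = 0} \<inter> (\<Inter>j<n. {y. \<bar>y j - x j\<bar> < d j})
        = {y. (\<forall>m\<ge>n. y m = 0) \<and> (\<forall>j<n. \<bar>y j - x j\<bar> < d j)}" by auto
    ultimately show ?thesis by simp
  qed
  have openB: "openin (Euclidean_space n) B" unfolding B_def by (rule box)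
  have contB: "continuous_on B g" using cont by (simp add: B_def)
  have subB: "subtopology (Euclidean_space n) B = top_of_set B"
    unfolding Euclidean_space_eq subtopology_subtopology by (simp add: B_def Int_absorb1 subset_eq)
  have openB': "openin (Euclidean_space n) {y \<in> B. g y \<in> T}" if "open T" for T
  proof -
    have "openin (top_of_set B) (B \<inter> g -` T)"
      using contB that by (rule continuous_openin_preimage_gen)
    moreover have "B \<inter> g -` T = {y \<in> B. g y \<in> T}" by auto
    ultimately show ?thesis
      using openB openin_trans_full[of "Euclidean_space n" B] subB by simp
  qed
  define c where "c = g x"
  \<comment> \<open>With \<open>\<epsilon>\<close> strictly below \<open>r\<close>, the closed
    interval of radius \<open>\<epsilon>\<close> about \<open>x i\<close> lies in the range where
    \<open>g\<close> is strictly increasing in direction \<open>i\<close>.\<close>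
  define \<epsilon> where "\<epsilon> = r / 2"
  have \<epsilon>: "0 < \<epsilon>" "\<epsilon> < r" using r by (auto simp: \<epsilon>_def)
  define xp where "xp = x(i := x i + \<epsilon>)"
  define xm where "xm = x(i := x i - \<epsilon>)"
  have "xp \<in> {y \<in> B. g y \<in> {c<..}}" "xm \<in> {y \<in> B. g y \<in> {..<c}}"
    using mono[of x "x i" "x i + \<epsilon>"] mono[of x "x i - \<epsilon>" "x i"] x \<epsilon> r i
    by (auto simp: xp_def xm_def B_def c_def)
  note x\<epsilon> = this
  obtain \<delta>1 where "\<delta>1 > 0"
      "\<And>y. \<lbrakk>\<forall>m\<ge>n. y m = 0; \<forall>j<n. \<bar>y j - xp j\<bar> < \<delta>1\<rbrakk> \<Longrightarrow> y \<in> {y \<in> B. g y \<in> {c<..}}"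
    by (rule openin_Euclidean_space_contains_box[OF openB'[OF open_greaterThan] x\<epsilon>(1)]) blast
  then have \<delta>1: "\<delta>1 > 0"
      "\<And>y. \<lbrakk>\<forall>m\<ge>n. y m = 0; \<forall>j<n. \<bar>y j - xp j\<bar> < \<delta>1\<rbrakk> \<Longrightarrow> g y > c"
    by auto
  obtain \<delta>2 where "\<delta>2 > 0"
      "\<And>y. \<lbrakk>\<forall>m\<ge>n. y m = 0; \<forall>j<n. \<bar>y j - xm j\<bar> < \<delta>2\<rbrakk> \<Longrightarrow> y \<in> {y \<in> B. g y \<in> {..<c}}"
    by (rule openin_Euclidean_space_contains_box[OF openB'[OF open_lessThan] x\<epsilon>(2)]) blast
  then have \<delta>2: "\<delta>2 > 0"
      "\<And>y. \<lbrakk>\<forall>m\<ge>n. y m = 0; \<forall>j<n. \<bar>y j - xm j\<bar> < \<delta>2\<rbrakk> \<Longrightarrow> g y < c"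
    by auto
  define \<delta> where "\<delta> = Min {\<epsilon>, \<delta>1, \<delta>2}"
  have \<delta>: "0 < \<delta>" "\<delta> \<le> \<epsilon>" "\<delta> \<le> \<delta>1" "\<delta> \<le> \<delta>2"
    using \<epsilon> \<delta>1 \<delta>2 by (auto simp: \<delta>_def)
  \<comment> \<open>The box \<open>Q\<close> has half-width \<open>\<epsilon>\<close> in direction
    \<open>i\<close> and \<open>\<delta>\<close> in the others. The choice of
    \<open>\<delta>\<close> keeps \<open>g\<close> below \<open>c\<close> on the lower face and
    above \<open>c\<close> on the upper face, so each line in direction \<open>i\<close> through
    \<open>Q\<close> crosses the level \<open>c\<close> exactly once.\<close>
  define d where "d j = (if j = i then \<epsilon> else \<delta>)" for j
  define Q where "Q = {y. (\<forall>m\<ge>n. y m = 0) \<and> (\<forall>j<n. \<bar>y j - x j\<bar> < d j)}"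
  have d: "0 < d j" "d j \<le> \<epsilon>" for j using \<delta> \<epsilon> by (auto simp: d_def)
  have QB: "Q \<subseteq> B"
    unfolding Q_def B_def using d(2) \<epsilon>(2) by (auto, smt (verit))
  have upd: "y(i := t) \<in> B" if "y \<in> Q" "\<bar>t - x i\<bar> \<le> \<epsilon>" for y t
    using that QB \<epsilon> i unfolding B_def by auto
  have cont_upd: "continuous_on A (\<lambda>a. g ((w a)(i := u a)))"
    if "\<And>a. a \<in> A \<Longrightarrow> w a \<in> Q" "\<And>a. a \<in> A \<Longrightarrow> \<bar>u a - x i\<bar> \<le> \<epsilon>"
      "\<And>j. continuous_on A (\<lambda>a. w a j)" "continuous_on A u"
    for A :: "'b::topological_space set" and w u
  proof -
    have "continuous_on A (\<lambda>a. (w a)(i := u a))"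
      by (intro continuous_on_fun_upd that)
    then show ?thesis
      using that upd by (intro continuous_on_compose2[OF contB]) auto
  qed
  have low: "g (y(i := x i - \<epsilon>)) < c" and high: "c < g (y(i := x i + \<epsilon>))" if "y \<in> Q" for y
    using that \<delta> d i by (auto intro!: \<delta>1(2) \<delta>2(2) simp: Q_def xp_def xm_def d_def)
      (smt (verit))+
  have uniq: "s = t" if "y \<in> Q" "\<bar>s - x i\<bar> \<le> \<epsilon>" "\<bar>t - x i\<bar> \<le> \<epsilon>" "g (y(i := s)) = g (y(i := t))" for y s t
    using that mono[of y s t] mono[of y t s] QB \<epsilon> unfolding B_def by (cases s t rule: linorder_cases) auto
  have ex: "\<exists>t. \<bar>t - x i\<bar> \<le> \<epsilon> \<and> g (y(i := t)) = c" if y: "y \<in> Q" for y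
  proof -
    have "continuous_on {x i - \<epsilon>..x i + \<epsilon>} (\<lambda>t. g (y(i := t)))"
      by (intro cont_upd) (use y in auto)
    then have "\<exists>t\<ge>x i - \<epsilon>. t \<le> x i + \<epsilon> \<and> g (y(i := t)) = c"
      by (intro IVT') (use low[OF y] high[OF y] \<epsilon> in auto)
    then obtain t where "x i - \<epsilon> \<le> t" "t \<le> x i + \<epsilon>" "g (y(i := t)) = c" by blast
    then show ?thesis by (intro exI[of _ t]) auto
  qed
  have "path_connected {y \<in> Q. g y = g x}"
    unfolding path_connected_def
  proof (intro ballI)
    fix y z assume y: "y \<in> {y \<in> Q. g y = g x}" and z: "z \<in> {y \<in> Q. g y = g x}"
    \<comment> \<open>The straight segment stays in the convex box \<open>Q\<close>; replacing its
      \<open>i\<close>-th coordinate by the implicit solution \<open>h s\<close> pushes it into the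
      level set.\<close>
    define w where "w s = (\<lambda>j. (1 - s) * y j + s * z j)" for s :: real
    have w: "w s \<in> Q" if "s \<in> {0..1}" for s
    proof -
      have "\<bar>w s j - x j\<bar> < d j" if "j < n" for j
      proof -
        have "\<bar>w s j - x j\<bar> = \<bar>(1 - s) * (y j - x j) + s * (z j - x j)\<bar>"
          by (simp add: w_def algebra_simps)
        also have "\<dots> \<le> (1 - s) * \<bar>y j - x j\<bar> + s * \<bar>z j - x j\<bar>"
          using \<open>s \<in> {0..1}\<close> by (intro order.trans[OF abs_triangle_ineq]) (simp add: abs_mult)
        also have "\<dots> < d j"
          using y z that \<open>s \<in> {0..1}\<close> by (intro convex_bound_lt) (auto simp: Q_def)
        finally show ?thesis .
      qed
      moreover have "\<forall>m\<ge>n. w s m = 0" using y z by (auto simp: w_def Q_def)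
      ultimately show ?thesis by (auto simp: Q_def)
    qed
    have wcont: "continuous_on A (\<lambda>a. w (u a) j)" if "continuous_on A u"
      for A :: "'b::topological_space set" and u j
      unfolding w_def by (intro continuous_intros that)
    have "\<exists>t. \<bar>t - x i\<bar> \<le> \<epsilon> \<and> g ((w s)(i := t)) = c" if "s \<in> {0..1}" for s
      using ex w that by blast
    then obtain h where h: "\<And>s. s \<in> {0..1} \<Longrightarrow> \<bar>h s - x i\<bar> \<le> \<epsilon>"
        "\<And>s. s \<in> {0..1} \<Longrightarrow> g ((w s)(i := h s)) = c"
      by metis
    have hu: "h s = t" if "s \<in> {0..1}" "\<bar>t - x i\<bar> \<le> \<epsilon>" "g ((w s)(i := t)) = c" for s t
      using uniq[OF w[OF that(1)]] h that by auto
    have hcont: "continuous_on {0..1} h"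
    proof (rule continuous_from_closed_graph)
      show "compact {x i - \<epsilon>..x i + \<epsilon>}" by simp
      show "h \<in> {0..1} \<rightarrow> {x i - \<epsilon>..x i + \<epsilon>}" using h(1) by (force simp: abs_le_iff)
      let ?P = "{0..1} \<times> {x i - \<epsilon>..x i + \<epsilon>}"
      have "continuous_on ?P (\<lambda>p. g ((w (fst p))(i := snd p)))"
        by (intro cont_upd wcont) (use w in \<open>auto intro!: continuous_intros\<close>)
      then have "closed {p \<in> ?P. g ((w (fst p))(i := snd p)) = c}"
        by (intro continuous_closed_preimage_constant closed_Times) auto
      moreover have "{p \<in> ?P. g ((w (fst p))(i := snd p)) = c} = (\<lambda>s. (s, h s)) ` {0..1}"
        using h hu by (auto simp: abs_le_iff image_iff) (smt (verit))+
      ultimately show "closed ((\<lambda>s. (s, h s)) ` {0..1})" by simp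
    qed
    define \<gamma> where "\<gamma> s = (w s)(i := h s)" for s
    \<comment> \<open>The solution was found in the closed interval; the strict signs on the two
      faces exclude its endpoints, so the lifted curve stays in the open box.\<close>
    have "h s \<noteq> x i - \<epsilon>" "h s \<noteq> x i + \<epsilon>" if "s \<in> {0..1}" for s
      using low[OF w[OF that]] high[OF w[OF that]] h(2)[OF that] by auto
    then have hlt: "\<bar>h s - x i\<bar> < \<epsilon>" if "s \<in> {0..1}" for s
      using h(1)[OF that] that by (smt (verit))
    have "\<gamma> s \<in> {y \<in> Q. g y = g x}" if "s \<in> {0..1}" for s
      using w[OF that] hlt[OF that] h(2)[OF that] i by (auto simp: \<gamma>_def Q_def c_def d_def)
    moreover have "continuous_on {0..1} \<gamma>"
      unfolding \<gamma>_def by (intro continuous_on_fun_upd hcont wcont continuous_on_id)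
    \<comment> \<open>At the ends the coordinates \<open>y i\<close> and \<open>z i\<close> already
      solve the equation, so uniqueness identifies them with \<open>h 0\<close> and
      \<open>h 1\<close>.\<close>
    moreover have "\<gamma> 0 = y" "\<gamma> 1 = z"
      using hu[of 0 "y i"] hu[of 1 "z i"] y z i
      by (auto simp: \<gamma>_def w_def Q_def d_def c_def less_imp_le)
    ultimately show "\<exists>\<gamma>. path \<gamma> \<and> path_image \<gamma> \<subseteq> {y \<in> Q. g y = g x} \<and> pathstart \<gamma> = y \<and> pathfinish \<gamma> = z"
      unfolding path_def path_image_def pathstart_def pathfinish_def by (intro exI[of _ \<gamma>]) auto
  qed
  moreover have "openin (Euclidean_space n) Q" unfolding Q_def by (rule box)
  moreover have "x \<in> Q" using x d by (auto simp: Q_def)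
  ultimately show thesis
    using that QB unfolding B_def by blast
qed

text \<open>The nonzero partial derivative keeps its sign near \<open>x\<close> by continuity, so by
  the mean value theorem \<open>g\<close> is strictly monotone in direction \<open>i\<close> on a
  small box.\<close>

lemma regular_point_level_set_path_connected:
  fixes g :: "(nat \<Rightarrow> real) \<Rightarrow> real" and x :: "nat \<Rightarrow> real"
  assumes V: "openin (Euclidean_space n) V" and g: "Ck_on n 1 V g"
    and i: "i < n" "partial_deriv i g x \<noteq> 0"
    and W: "openin (Euclidean_space n) W" "x \<in> W" "W \<subseteq> V"
  obtains Q where "openin (Euclidean_space n) Q" "x \<in> Q" "Q \<subseteq> W"
    "path_connectedin (Euclidean_space n) {y \<in> Q. g y = g x}"
proof -
  \<comment> \<open>Multiplying by the sign reduces to the increasing case and leaves the level sets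
    unchanged.\<close>
  define \<sigma> where "\<sigma> = sgn (partial_deriv i g x)"
  have \<sigma>: "\<sigma> \<noteq> 0" "\<sigma> * partial_deriv i g x > 0"
    using i by (auto simp: \<sigma>_def sgn_if)
  have VE: "V \<subseteq> {y. \<forall>m\<ge>n. y m = 0}"
    using openin_subset[OF V] by (simp add: topspace_Euclidean_space)
  have subV: "subtopology (Euclidean_space n) V = top_of_set V"
    unfolding Euclidean_space_eq subtopology_subtopology using VE by (simp add: Int_absorb1)
  have gV: "continuous_on V g" "continuous_on V (partial_deriv i g)"
    and diff: "\<And>y. y \<in> V \<Longrightarrow> (\<lambda>t. g (y(i := t))) differentiable (at (y i))"
    using g i subV by auto
  define P where "P = V \<inter> (\<lambda>y. \<sigma> * partial_deriv i g y) -` {0<..}"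
  have "openin (top_of_set V) P"
    unfolding P_def
    by (intro continuous_openin_preimage_gen continuous_on_mult_left gV open_greaterThan)
  then have "openin (Euclidean_space n) P"
    using V openin_trans_full[of "Euclidean_space n" V] subV by simp
  then have "openin (Euclidean_space n) (W \<inter> P)" "x \<in> W \<inter> P"
    using W \<sigma> by (auto simp: P_def)
  then obtain r where r: "r > 0"
      "\<And>y. \<lbrakk>\<forall>m\<ge>n. y m = 0; \<forall>j<n. \<bar>y j - x j\<bar> < r\<rbrakk> \<Longrightarrow> y \<in> W \<inter> P"
    by (rule openin_Euclidean_space_contains_box) blast
  have x: "\<forall>m\<ge>n. x m = 0" using W VE by auto
  obtain Q where Q: "openin (Euclidean_space n) Q" "x \<in> Q"
      "\<And>y j. \<lbrakk>y \<in> Q; j < n\<rbrakk> \<Longrightarrow> \<bar>y j - x j\<bar> < r"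
      "path_connected {y \<in> Q. \<sigma> * g y = \<sigma> * g x}"
  proof (rule monotone_level_set_path_connected[OF i(1) x r(1)])
    show "continuous_on {y. (\<forall>m\<ge>n. y m = 0) \<and> (\<forall>j<n. \<bar>y j - x j\<bar> < r)} (\<lambda>y. \<sigma> * g y)"
      by (intro continuous_intros continuous_on_subset[OF gV(1)]) (use r(2) W in blast)
    fix y s t
    assume y: "\<forall>m\<ge>n. y m = 0" "\<forall>j<n. \<bar>y j - x j\<bar> < r"
      and st: "\<bar>s - x i\<bar> < r" "\<bar>t - x i\<bar> < r" "s < t"
    show "\<sigma> * g (y(i := s)) < \<sigma> * g (y(i := t))"
    proof (rule DERIV_pos_imp_increasing[OF st(3)])
      fix u assume "s \<le> u" "u \<le> t"
      then have "y(i := u) \<in> W \<inter> P"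
        using y st i by (intro r(2)) auto
      then have u: "y(i := u) \<in> V" "\<sigma> * partial_deriv i g (y(i := u)) > 0"
        by (auto simp: P_def)
      have "((\<lambda>t. g (y(i := t))) has_real_derivative partial_deriv i g (y(i := u))) (at u)"
        using diff[OF u(1)] by (simp add: partial_deriv_def DERIV_deriv_iff_real_differentiable)
      then show "\<exists>D. ((\<lambda>t. \<sigma> * g (y(i := t))) has_real_derivative D) (at u) \<and> D > 0"
        using u(2) DERIV_cmult by blast
    qed
  qed blast
  show thesis
  proof
    have QE: "Q \<subseteq> {y. \<forall>m\<ge>n. y m = 0}"
      using openin_subset[OF Q(1)] by (simp add: topspace_Euclidean_space)
    then show "Q \<subseteq> W" using Q(3) r(2) by blast
    have "path_connected {y \<in> Q. g y = g x}" using Q(4) \<sigma>(1) by simp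
    moreover have "{y \<in> Q. g y = g x} \<subseteq> {y. \<forall>m\<ge>n. y m = 0}" using QE by blast
    ultimately show "path_connectedin (Euclidean_space n) {y \<in> Q. g y = g x}"
      unfolding Euclidean_space_eq path_connectedin_subtopology by simp
  qed (use Q in auto)
qed

section \<open>Fibres of smooth functions on manifolds\<close>

text \<open>The chart carries \<open>Z \<inter> U\<close> to an open subset of Euclidean space. The
  neighbourhood found there is pulled back by \<open>\<phi>\<close>, and the path-connected level
  set is transported by the continuous inverse \<open>\<psi>\<close>.\<close>

lemma chart_regular_point_level_set_path_connected:
  fixes f :: "'a \<Rightarrow> real"
  assumes chart: "is_chart n M (U, \<phi>)" and f: "smooth_real_on n (\<phi> ` U) (f \<circ> inv_into U \<phi>)"
    and x: "x \<in> U" and i: "i < n" "partial_deriv i (f \<circ> inv_into U \<phi>) (\<phi> x) \<noteq> 0"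
    and Z: "openin M Z" "x \<in> Z"
  obtains Q where "openin M Q" "x \<in> Q" "Q \<subseteq> Z" "path_connectedin M {y \<in> Q. f y = f x}"
proof -
  have U: "openin M U" and \<phi>U: "openin (Euclidean_space n) (\<phi> ` U)"
    and hom: "homeomorphic_map (subtopology M U) (subtopology (Euclidean_space n) (\<phi> ` U)) \<phi>"
    using chart by (auto simp: is_chart_def)
  obtain \<psi> where \<psi>: "homeomorphic_maps (subtopology M U)
      (subtopology (Euclidean_space n) (\<phi> ` U)) \<phi> \<psi>"
    using hom homeomorphic_map_maps by blast
  have topU: "topspace (subtopology M U) = U"
    using openin_subset[OF U] by auto
  have \<psi>\<phi>: "\<psi> (\<phi> y) = y" if "y \<in> U" for y
    using \<psi> that topU unfolding homeomorphic_maps_def by blast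
  have inj: "inj_on \<phi> U" using \<psi>\<phi> by (metis inj_onI)
  have \<phi>cont: "continuous_map (subtopology M U) (subtopology (Euclidean_space n) (\<phi> ` U)) \<phi>"
    and \<psi>cont: "continuous_map (subtopology (Euclidean_space n) (\<phi> ` U)) (subtopology M U) \<psi>"
    using \<psi> unfolding homeomorphic_maps_def by auto
  define g where "g = f \<circ> inv_into U \<phi>"
  have g: "g (\<phi> y) = f y" if "y \<in> U" for y
    using that inj by (simp add: g_def inv_into_f_f)
  have "openin (subtopology M U) (Z \<inter> U)"
    using Z U by (simp add: openin_open_subtopology openin_Int)
  then have "openin (subtopology (Euclidean_space n) (\<phi> ` U)) (\<phi> ` (Z \<inter> U))"
    using homeomorphic_imp_open_map[OF hom] unfolding open_map_def by blast
  then have W: "openin (Euclidean_space n) (\<phi> ` (Z \<inter> U))"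
    using \<phi>U openin_trans_full by blast
  have "Ck_on n 1 (\<phi> ` U) g" using f unfolding smooth_real_on_def g_def by blast
  then obtain Q where Q: "openin (Euclidean_space n) Q" "\<phi> x \<in> Q" "Q \<subseteq> \<phi> ` (Z \<inter> U)"
      "path_connectedin (Euclidean_space n) {y \<in> Q. g y = g (\<phi> x)}"
    by (rule regular_point_level_set_path_connected[OF \<phi>U _ i(1) i(2)[folded g_def] W])
      (use x Z in auto)
  have QU: "Q \<subseteq> \<phi> ` U" using Q(3) by blast
  show thesis
  proof
    let ?Q = "{y \<in> U. \<phi> y \<in> Q}"
    have "openin (subtopology (Euclidean_space n) (\<phi> ` U)) Q"
      using Q(1) \<phi>U QU by (simp add: openin_open_subtopology)
    from openin_continuous_map_preimage[OF \<phi>cont this]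
    have "openin (subtopology M U) ?Q" unfolding topU .
    then show "openin M ?Q" using U by (rule openin_trans_full)
    show "x \<in> ?Q" using x Q by simp
    show "?Q \<subseteq> Z"
    proof
      fix y assume "y \<in> ?Q"
      then obtain z where "z \<in> Z \<inter> U" "\<phi> y = \<phi> z" "y \<in> U" using Q(3) by auto
      then show "y \<in> Z" using inj_onD[OF inj] by auto
    qed
    have "path_connectedin (subtopology (Euclidean_space n) (\<phi> ` U)) {y \<in> Q. g y = g (\<phi> x)}"
      using Q(4) QU unfolding path_connectedin_subtopology by blast
    then have "path_connectedin (subtopology M U) (\<psi> ` {y \<in> Q. g y = g (\<phi> x)})"
      by (rule path_connectedin_continuous_map_image[OF \<psi>cont])
    moreover have "\<psi> ` {y \<in> Q. g y = g (\<phi> x)} = {y \<in> ?Q. f y = f x}"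
    proof (intro equalityI subsetI)
      fix z assume "z \<in> \<psi> ` {y \<in> Q. g y = g (\<phi> x)}"
      then obtain y where "y \<in> Q" "g y = g (\<phi> x)" "z = \<psi> y" by blast
      moreover from this obtain z' where "z' \<in> U" "y = \<phi> z'" using QU by blast
      ultimately show "z \<in> {y \<in> ?Q. f y = f x}" using \<psi>\<phi> g x by auto
    next
      fix z assume "z \<in> {y \<in> ?Q. f y = f x}"
      then show "z \<in> \<psi> ` {y \<in> Q. g y = g (\<phi> x)}"
        using \<psi>\<phi> g x by (intro image_eqI[of _ _ "\<phi> z"]) auto
    qed
    ultimately show "path_connectedin M {y \<in> ?Q. f y = f x}"
      by (simp add: path_connectedin_subtopology)
  qed
qed

text \<open>Order zero of \<open>Ck_on\<close> is continuity in each chart, and the chart domains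
  form an open cover, so the pieces paste together. This makes the fibres closed and hence
  compact.\<close>

lemma continuous_map_smooth_function:
  assumes M: "smooth_atlas n M \<A>" and f: "smooth_function n \<A> f"
  shows "continuous_map M euclideanreal f"
proof (rule pasting_lemma[where I = \<A> and T = fst and f = "\<lambda>_. f"])
  fix c assume c: "c \<in> \<A>"
  obtain U \<phi> where U\<phi>: "c = (U, \<phi>)" by (cases c)
  have chart: "is_chart n M (U, \<phi>)" using M c unfolding smooth_atlas_def U\<phi> by blast
  then show "openin M (fst c)" by (simp add: U\<phi> is_chart_def)
  have hom: "homeomorphic_map (subtopology M U) (subtopology (Euclidean_space n) (\<phi> ` U)) \<phi>"
    and U: "openin M U"
    using chart by (auto simp: is_chart_def)
  have topU: "topspace (subtopology M U) = U"
    using openin_subset[OF U] by auto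
  have inj: "inj_on \<phi> U"
    using homeomorphic_imp_injective_map[OF hom] topU by simp
  have "Ck_on n 0 (\<phi> ` U) (f \<circ> inv_into U \<phi>)"
    using f c unfolding smooth_function_def smooth_real_on_def U\<phi> by blast
  then have "continuous_map (subtopology M U) euclideanreal ((f \<circ> inv_into U \<phi>) \<circ> \<phi>)"
    using continuous_map_compose[OF homeomorphic_imp_continuous_map[OF hom]] by simp
  then show "continuous_map (subtopology M (fst c)) euclideanreal f"
    unfolding U\<phi> fst_conv
    by (rule continuous_map_eq) (use topU inj in \<open>simp add: inv_into_f_f\<close>)
next
  fix x assume "x \<in> topspace M"
  then show "\<exists>c. c \<in> \<A> \<and> x \<in> fst c \<and> f x = f x"
    using M unfolding smooth_atlas_def by force
qed auto

theorem proposition4p4: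
  fixes M :: "'a topology" and \<A> :: "'a chart set" and n :: nat and f :: "'a \<Rightarrow> real"
  assumes "closed_smooth_manifold n M \<A>"
    and "smooth_function n \<A> f"
    and "finite {p \<in> topspace M. critical_point n \<A> f p}"
  shows "Reeb_space M f = path_Reeb_space M f"
proof -
  define S where "S = {p \<in> topspace M. critical_point n \<A> f p}"
  have S: "finite S" using assms(3) by (simp add: S_def)
  have M: "compact_space M" "Hausdorff_space M" "second_countable M" and atlas: "smooth_atlas n M \<A>"
    using assms(1) by (auto simp: closed_smooth_manifold_def smooth_manifold_def)
  have fibre: "path_component_of_set (fibre_through M f x) y = connected_component_of_set (fibre_through M f x) y"
    for x y
  proof (rule path_component_eq_connected_component_of_isolated[OF _ _ _ S])
    define F where "F = {z \<in> topspace M. f z = f x}"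
    have F: "fibre_through M f x = subtopology M F"
      by (simp add: fibre_through_def F_def)
    have "closedin M {z \<in> topspace M. f z \<in> {f x}}"
      using continuous_map_smooth_function[OF atlas assms(2)]
      by (rule closedin_continuous_map_preimage) simp
    then have "closedin M F" by (simp add: F_def)
    then show "compact_space (fibre_through M f x)"
      using M by (simp add: F closedin_compact_space compact_space_subtopology)
    show "Hausdorff_space (fibre_through M f x)" "first_countable (fibre_through M f x)"
      using M by (simp_all add: F Hausdorff_space_subtopology second_countable_imp_first_countable
          second_countable_subtopology)
    \<comment> \<open>\<open>L\<close> is the regular part of the fibre, where level sets in
      suitable neighbourhoods are path-connected.\<close>
    define L where "L = subtopology M (F - S)"
    have "subtopology (fibre_through M f x) (topspace (fibre_through M f x) - S) = L"
    proof -
      have "F \<inter> (topspace M \<inter> F - S) = F - S" by (auto simp: F_def)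
      then show ?thesis by (simp add: F L_def subtopology_subtopology)
    qed
    moreover have "locally_path_connected_space L"
      unfolding locally_path_connected_space
    proof (intro allI impI, elim conjE)
      fix V y assume V: "openin L V" "y \<in> V"
      then obtain Z where Z: "openin M Z" "V = Z \<inter> (F - S)"
        by (auto simp: L_def openin_subtopology)
      have y: "y \<in> topspace M" "y \<notin> S" "f y = f x" "y \<in> Z"
        using V Z by (auto simp: F_def)
      have "closedin M S"
        using M S by (intro closedin_Hausdorff_finite) (auto simp: S_def)
      \<comment> \<open>Shrinking \<open>Z\<close> away from the critical points ensures that the
        level set in the neighbourhood \<open>Q\<close> found below is exactly
        \<open>Q \<inter> (F - S)\<close>, an open set of \<open>L\<close>.\<close>
      then have ZS: "openin M (Z - S)" "y \<in> Z - S" using Z y by auto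
      obtain U \<phi> where U\<phi>: "(U, \<phi>) \<in> \<A>" "y \<in> U"
        using atlas y(1) unfolding smooth_atlas_def by blast
      \<comment> \<open>Being critical is existential over charts, so the noncritical point
        \<open>y\<close> has a nonzero partial derivative in whichever chart was chosen.\<close>
      then obtain i where i: "i < n" "partial_deriv i (f \<circ> inv_into U \<phi>) (\<phi> y) \<noteq> 0"
        using y unfolding S_def critical_point_def by blast
      have chart: "is_chart n M (U, \<phi>)" "smooth_real_on n (\<phi> ` U) (f \<circ> inv_into U \<phi>)"
        using U\<phi>(1) atlas assms(2) by (auto simp: smooth_atlas_def smooth_function_def)
      obtain Q where Q: "openin M Q" "y \<in> Q" "Q \<subseteq> Z - S"
          "path_connectedin M {z \<in> Q. f z = f y}"
        by (rule chart_regular_point_level_set_path_connected[OF chart U\<phi>(2) i ZS]) blast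
      have eq: "{z \<in> Q. f z = f y} = Q \<inter> (F - S)"
        using Q openin_subset[OF Q(1)] y by (auto simp: F_def)
      show "\<exists>U. openin L U \<and> path_connectedin L U \<and> y \<in> U \<and> U \<subseteq> V"
      proof (intro exI conjI)
        show "openin L (Q \<inter> (F - S))"
          using Q by (auto simp: L_def openin_subtopology)
        show "path_connectedin L (Q \<inter> (F - S))"
          using Q eq by (simp add: L_def path_connectedin_subtopology)
        show "y \<in> Q \<inter> (F - S)" using Q V Z by blast
        show "Q \<inter> (F - S) \<subseteq> V" using Q Z by blast
      qed
    qed
    ultimately show "locally_path_connected_space
        (subtopology (fibre_through M f x) (topspace (fibre_through M f x) - S))"
      by simp
  qed
  have "path_component_of (fibre_through M f x) y z \<longleftrightarrow> connected_component_of (fibre_through M f x) y z"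
    for x y z
    using fibre[of x y] by (simp add: set_eq_iff)
  \<comment> \<open>Equality of the relations gives the same classes and the same quotient topology,
    not merely homeomorphic spaces.\<close>
  then have "Reeb_rel M f = path_Reeb_rel M f"
    by (simp add: Reeb_rel_def path_Reeb_rel_def)
  then show ?thesis
    by (simp add: Reeb_space_def path_Reeb_space_def)
qed

end
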